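(* Let $\Sigma=(X,X_0,S,U,\to,Y,h)$ be a total NFTS and $\Sigma_V$ its verification system with state set $X_V$. Then $\Sigma$ is initial-state opaque if and only if for every $(q^1,q^2)\in X_V$: if $q^2\cap X_0\neq\emptyset$ then $q^2\cap X_0\not\subseteq S$.
   Context: An NFTS is a tuple $\Sigma=(X,X_0,S,U,\to,Y,h)$ with $X$ a finite set of states, $X_0\subseteq X$ initial states, $S\subseteq X$ secret states, $U$ a finite set of inputs, $\to\subseteq X\times U\times X$ the transition relation (write $x\xrightarrow{u}x'$), $Y$ a set of outputs and $h:X\to Y$. It is total if for every $x\in X$, $u\in U$ there is $x'$ with $x\xrightarrow{u}x'$. For $\alpha=\alpha(0)\cdots\alpha(|\alpha|-1)\in U^*$ (finite sequences, including empty), a run over $\alpha$ is a nonempty sequence $x_0\dots x_k$ with $k\le|\alpha|$, $x_0\in X_0$, $(x_j,\alpha(j),x_{j+1})\in\to$ for $j<k$; it is maximal if $k=|\alpha|$ or no $x'$ satisfies $(x_k,\alpha(k),x')\in\to$. $\Sigma$ is initial-state opaque if for every $\alpha\in U^*$ and every maximal run $x_0\dots x_k$ over $\alpha$ with $x_0\in X_0\cap S$ there is a maximal run $x_0'\dots x_k'$ over $\alpha$ with $x_0'\notin S$ and $h(x_j)=h(x_j')$ for all $j\in\{0,\dots,k\}$. For $y\in Y$ let $X_y=\{x\mid h(x)=y\}$, $X_{0,y}=X_0\cap X_y$; for $q\subseteq X$, $u\in U$, $\mathrm{suc}(q,u)=\{x\mid\exists x'\in q,(x',u,x)\in\to\}$,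 $\mathrm{post}(q,u)=\{x\mid\exists x'\in q,(x,u,x')\in\to\}$. Let $\epsilon\notin U$. The verification system $\Sigma_V$ has input set $U_V=(U\times\{\epsilon\})\cup(\{\epsilon\}\times U)$, initial states $X_{V,0}=\{(X_{0,y_1},X_{y_2})\mid y_1,y_2\in Y,\ X_{0,y_1}\neq\emptyset,\ X_{y_2}\neq\emptyset\}$, transitions $(q_1,q_2)\xrightarrow{(u,\epsilon)}_V(q_1',q_2)$ iff $q_1'=\mathrm{suc}(q_1,u)\cap X_y\neq\emptyset$ for some $y\in Y$, and $(q_1,q_2)\xrightarrow{(\epsilon,u)}_V(q_1,q_2')$ iff $q_2'=\mathrm{post}(q_2,u)\cap X_y\neq\emptyset$ for some $y\in Y$; its state set $X_V$ is the set of pairs reachable from $X_{V,0}$ by finitely many transitions. *)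

theory Defs
  imports Main
begin

record ('x, 'u, 'y) nfts =
  states :: "'x set"
  init :: "'x set"
  secret :: "'x set"
  inputs :: "'u set"
  step :: "('x \<times> 'u \<times> 'x) set"
  outputs :: "'y set"
  out :: "'x \<Rightarrow> 'y"

definition is_nfts :: "('x, 'u, 'y) nfts \<Rightarrow> bool" where
  "is_nfts \<Sigma> \<longleftrightarrow>
     finite (states \<Sigma>) \<and> init \<Sigma> \<subseteq> states \<Sigma> \<and> secret \<Sigma> \<subseteq> states \<Sigma> \<and>
     finite (inputs \<Sigma>) \<and> step \<Sigma> \<subseteq> states \<Sigma> \<times> inputs \<Sigma> \<times> states \<Sigma> \<and>
     out \<Sigma> ` states \<Sigma> \<subseteq> outputs \<Sigma>"

definition is_total :: "('x, 'u, 'y) nfts \<Rightarrow> bool" where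
  "is_total \<Sigma> \<longleftrightarrow>
     (\<forall>x\<in>states \<Sigma>. \<forall>u\<in>inputs \<Sigma>. \<exists>x'\<in>states \<Sigma>. (x, u, x') \<in> step \<Sigma>)"

text \<open>A run \<open>x\<^sub>0 \<dots> x\<^sub>k\<close> is the list \<open>xs\<close> of its states, so \<open>k = length xs - 1\<close>.\<close>

definition is_run :: "('x, 'u, 'y) nfts \<Rightarrow> 'u list \<Rightarrow> 'x list \<Rightarrow> bool" where
  "is_run \<Sigma> \<alpha> xs \<longleftrightarrow>
     xs \<noteq> [] \<and> length xs - 1 \<le> length \<alpha> \<and> xs ! 0 \<in> init \<Sigma> \<and>
     (\<forall>j < length xs - 1. (xs ! j, \<alpha> ! j, xs ! (j + 1)) \<in> step \<Sigma>)"

definition is_maximal_run :: "('x, 'u, 'y) nfts \<Rightarrow> 'u list \<Rightarrow> 'x list \<Rightarrow> bool" where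
  "is_maximal_run \<Sigma> \<alpha> xs \<longleftrightarrow>
     is_run \<Sigma> \<alpha> xs \<and>
     (length xs - 1 = length \<alpha> \<or>
      \<not> (\<exists>x'. (xs ! (length xs - 1), \<alpha> ! (length xs - 1), x') \<in> step \<Sigma>))"

definition initial_state_opaque :: "('x, 'u, 'y) nfts \<Rightarrow> bool" where
  "initial_state_opaque \<Sigma> \<longleftrightarrow>
     (\<forall>\<alpha>\<in>lists (inputs \<Sigma>). \<forall>xs.
        is_maximal_run \<Sigma> \<alpha> xs \<and> xs ! 0 \<in> init \<Sigma> \<inter> secret \<Sigma> \<longrightarrow>
        (\<exists>xs'. is_maximal_run \<Sigma> \<alpha> xs' \<and> length xs' = length xs \<and>
               xs' ! 0 \<notin> secret \<Sigma> \<and>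
               (\<forall>j < length xs. out \<Sigma> (xs ! j) = out \<Sigma> (xs' ! j))))"

definition states_out :: "('x, 'u, 'y) nfts \<Rightarrow> 'y \<Rightarrow> 'x set" where
  "states_out \<Sigma> y = {x \<in> states \<Sigma>. out \<Sigma> x = y}"

definition init_out :: "('x, 'u, 'y) nfts \<Rightarrow> 'y \<Rightarrow> 'x set" where
  "init_out \<Sigma> y = init \<Sigma> \<inter> states_out \<Sigma> y"

definition suc :: "('x, 'u, 'y) nfts \<Rightarrow> 'x set \<Rightarrow> 'u \<Rightarrow> 'x set" where
  "suc \<Sigma> q u = {x \<in> states \<Sigma>. \<exists>x'\<in>q. (x', u, x) \<in> step \<Sigma>}"

text \<open>Despite its name, \<open>post\<close> collects the predecessors of \<open>q\<close>.\<close>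

definition post :: "('x, 'u, 'y) nfts \<Rightarrow> 'x set \<Rightarrow> 'u \<Rightarrow> 'x set" where
  "post \<Sigma> q u = {x \<in> states \<Sigma>. \<exists>x'\<in>q. (x, u, x') \<in> step \<Sigma>}"

text \<open>
  In the inputs of the verification system, \<open>None\<close> plays the role of the fresh symbol
  \<open>\<epsilon> \<notin> U\<close>, and \<open>u \<in> U\<close> is represented by \<open>Some u\<close>.
\<close>

definition ver_inputs :: "('x, 'u, 'y) nfts \<Rightarrow> ('u option \<times> 'u option) set" where
  "ver_inputs \<Sigma> = (Some ` inputs \<Sigma> \<times> {None}) \<union> ({None} \<times> Some ` inputs \<Sigma>)"

definition ver_init :: "('x, 'u, 'y) nfts \<Rightarrow> ('x set \<times> 'x set) set" where
  "ver_init \<Sigma> =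
     {(init_out \<Sigma> y1, states_out \<Sigma> y2) | y1 y2.
        y1 \<in> outputs \<Sigma> \<and> y2 \<in> outputs \<Sigma> \<and>
        init_out \<Sigma> y1 \<noteq> {} \<and> states_out \<Sigma> y2 \<noteq> {}}"

inductive ver_step ::
  "('x, 'u, 'y) nfts \<Rightarrow> 'x set \<times> 'x set \<Rightarrow> 'u option \<times> 'u option \<Rightarrow> 'x set \<times> 'x set \<Rightarrow> bool"
  for \<Sigma> :: "('x, 'u, 'y) nfts" where
  forward:
    "\<lbrakk>u \<in> inputs \<Sigma>; y \<in> outputs \<Sigma>; q1' = suc \<Sigma> q1 u \<inter> states_out \<Sigma> y; q1' \<noteq> {}\<rbrakk>
     \<Longrightarrow> ver_step \<Sigma> (q1, q2) (Some u, None) (q1', q2)"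
| backward:
    "\<lbrakk>u \<in> inputs \<Sigma>; y \<in> outputs \<Sigma>; q2' = post \<Sigma> q2 u \<inter> states_out \<Sigma> y; q2' \<noteq> {}\<rbrakk>
     \<Longrightarrow> ver_step \<Sigma> (q1, q2) (None, Some u) (q1, q2')"

definition ver_states :: "('x, 'u, 'y) nfts \<Rightarrow> ('x set \<times> 'x set) set" where
  "ver_states \<Sigma> =
     {p. \<exists>p0\<in>ver_init \<Sigma>. (\<lambda>p p'. \<exists>v\<in>ver_inputs \<Sigma>. ver_step \<Sigma> p v p')\<^sup>*\<^sup>* p0 p}"

end

theory Submission imports Defs begin

text \<open>
  Since the second component of the verification system evolves backwards, its value after
  reading \<open>\<alpha>\<close> in reverse is the set of all start states of paths over \<open>\<alpha>\<close> that produce some fixed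
  output sequence; if initial states exist, every nonempty such set occurs. By totality, the maximal runs
  over \<open>\<alpha>\<close> are exactly the paths of full length that start in an initial state. Hence opacity says that
  no such set meets the initial states in secret states only.
\<close>

text \<open>No condition on \<open>init\<close> is imposed, because the second component of the
  verification system starts from all states with a given output. For the empty word there is no
  transition to constrain the single state, so membership in \<open>states\<close> is demanded
  separately.\<close>

definition full_path :: "('x, 'u, 'y) nfts \<Rightarrow> 'u list \<Rightarrow> 'x list \<Rightarrow> bool" where
  "full_path \<Sigma> \<alpha> xs \<longleftrightarrow>
     length xs = Suc (length \<alpha>) \<and> set xs \<subseteq> states \<Sigma> \<and>
     (\<forall>j < length \<alpha>. (xs ! j, \<alpha> ! j, xs ! Suc j) \<in> step \<Sigma>)"

definition starts :: "('x, 'u, 'y) nfts \<Rightarrow> 'u list \<Rightarrow> 'y list \<Rightarrow> 'x set" where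
  "starts \<Sigma> \<alpha> ys = {xs ! 0 | xs. full_path \<Sigma> \<alpha> xs \<and> map (out \<Sigma>) xs = ys}"

lemma full_path_Nil: "full_path \<Sigma> [] xs \<longleftrightarrow> (\<exists>x\<in>states \<Sigma>. xs = [x])"
  by (auto simp: full_path_def length_Suc_conv)

text \<open>The case \<open>xs = []\<close>, where \<open>xs ! 0\<close> is unspecified, is
  harmless: both sides then fail on the length condition.\<close>

lemma full_path_Cons:
  "full_path \<Sigma> (u # \<alpha>) (x # xs) \<longleftrightarrow>
     x \<in> states \<Sigma> \<and> (x, u, xs ! 0) \<in> step \<Sigma> \<and> full_path \<Sigma> \<alpha> xs"
  by (auto simp: full_path_def All_less_Suc2)

lemma full_path_not_Nil: "\<not> full_path \<Sigma> \<alpha> []"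
  by (simp add: full_path_def)

lemma starts_Nil: "starts \<Sigma> [] [y] = states_out \<Sigma> y"
  by (force simp: starts_def states_out_def full_path_Nil)

text \<open>This is exactly the update made by a backward transition: since \<open>post\<close>
  takes predecessors, each new letter and output goes to the front of the word.\<close>

lemma starts_Cons:
  "starts \<Sigma> (u # \<alpha>) (y # ys) = post \<Sigma> (starts \<Sigma> \<alpha> ys) u \<inter> states_out \<Sigma> y"
proof (intro set_eqI iffI)
  fix x assume "x \<in> starts \<Sigma> (u # \<alpha>) (y # ys)"
  then obtain xs where "full_path \<Sigma> (u # \<alpha>) (x # xs)" "out \<Sigma> x = y" "map (out \<Sigma>) xs = ys"
    by (auto simp: starts_def map_eq_Cons_conv)
  then show "x \<in> post \<Sigma> (starts \<Sigma> \<alpha> ys) u \<inter> states_out \<Sigma> y"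
    by (auto simp: full_path_Cons starts_def post_def states_out_def)
next
  fix x assume "x \<in> post \<Sigma> (starts \<Sigma> \<alpha> ys) u \<inter> states_out \<Sigma> y"
  then obtain xs where "full_path \<Sigma> (u # \<alpha>) (x # xs)" "map (out \<Sigma>) (x # xs) = y # ys"
    by (auto simp: full_path_Cons starts_def post_def states_out_def)
  then show "x \<in> starts \<Sigma> (u # \<alpha>) (y # ys)"
    unfolding starts_def by (metis (mono_tags, lifting) mem_Collect_eq nth_Cons_0)
qed

lemma is_maximal_run_iff_full_path:
  assumes nfts: "is_nfts \<Sigma>" and total: "is_total \<Sigma>" and \<alpha>: "\<alpha> \<in> lists (inputs \<Sigma>)"
  shows "is_maximal_run \<Sigma> \<alpha> xs \<longleftrightarrow> full_path \<Sigma> \<alpha> xs \<and> xs ! 0 \<in> init \<Sigma>"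
proof
  assume run: "is_maximal_run \<Sigma> \<alpha> xs"
  have r: "xs \<noteq> []" "length xs - 1 \<le> length \<alpha>" "xs ! 0 \<in> init \<Sigma>"
    "\<And>j. j < length xs - 1 \<Longrightarrow> (xs ! j, \<alpha> ! j, xs ! Suc j) \<in> step \<Sigma>"
    using run by (auto simp: is_maximal_run_def is_run_def)
  \<comment> \<open>Totality speaks only of members of \<open>states\<close>, which
    \<open>is_run\<close> does not mention. The first state gets membership from
    \<open>init\<close>, every later one as the target of a transition.\<close>
  have states: "xs ! j \<in> states \<Sigma>" if "j < length xs" for j
  proof (cases j)
    case 0
    then show ?thesis using r(3) nfts by (auto simp: is_nfts_def)
  next
    case (Suc i)
    then have "(xs ! i, \<alpha> ! i, xs ! j) \<in> step \<Sigma>" using r(4)[of i] that by simp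
    then show ?thesis using nfts by (auto simp: is_nfts_def)
  qed
  \<comment> \<open>A run that stops early could be prolonged by totality, against
    maximality.\<close>
  have len: "length xs - 1 = length \<alpha>"
  proof (rule ccontr)
    assume ne: "length xs - 1 \<noteq> length \<alpha>"
    then have "\<alpha> ! (length xs - 1) \<in> inputs \<Sigma>" using r(2) \<alpha> by auto
    then have "\<exists>x'. (xs ! (length xs - 1), \<alpha> ! (length xs - 1), x') \<in> step \<Sigma>"
      using total states[of "length xs - 1"] r(1) by (auto simp: is_total_def)
    then show False using run ne by (simp add: is_maximal_run_def)
  qed
  have "length xs = Suc (length \<alpha>)" using len r(1) by (cases xs) auto
  then show "full_path \<Sigma> \<alpha> xs \<and> xs ! 0 \<in> init \<Sigma>"
    using r states by (auto simp: full_path_def in_set_conv_nth)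
next
  assume "full_path \<Sigma> \<alpha> xs \<and> xs ! 0 \<in> init \<Sigma>"
  then show "is_maximal_run \<Sigma> \<alpha> xs"
    by (auto simp: is_maximal_run_def is_run_def full_path_def)
qed

text \<open>An invariant of reachability: forward transitions keep the second component, backward
  ones extend the word by \<open>starts_Cons\<close>.\<close>

lemma ver_states_starts:
  assumes "(q1, q2) \<in> ver_states \<Sigma>"
  shows "\<exists>\<alpha>\<in>lists (inputs \<Sigma>). \<exists>ys. q2 = starts \<Sigma> \<alpha> ys"
proof -
  obtain p0 where p0: "p0 \<in> ver_init \<Sigma>"
    and reach: "(\<lambda>p p'. \<exists>v\<in>ver_inputs \<Sigma>. ver_step \<Sigma> p v p')\<^sup>*\<^sup>* p0 (q1, q2)"
    using assms by (auto simp: ver_states_def)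
  \<comment> \<open>Writing \<open>snd (q1, q2)\<close> presents the claim as a property of the
    whole pair, as the induction rule needs.\<close>
  from reach have "\<exists>\<alpha>\<in>lists (inputs \<Sigma>). \<exists>ys. snd (q1, q2) = starts \<Sigma> \<alpha> ys"
  proof (induction rule: rtranclp_induct)
    case base
    have "\<exists>y. snd p0 = states_out \<Sigma> y" using p0 by (auto simp: ver_init_def)
    then obtain y where "snd p0 = states_out \<Sigma> y" ..
    then show ?case using starts_Nil[of \<Sigma> y] by (metis lists.Nil)
  next
    case (step p p')
    then obtain \<alpha> ys where \<alpha>: "\<alpha> \<in> lists (inputs \<Sigma>)" "snd p = starts \<Sigma> \<alpha> ys" by blast
    obtain v where "ver_step \<Sigma> p v p'" using step.hyps(2) by blast
    then show ?case
    proof cases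
      case (forward u y q1' q1 q2)
      then show ?thesis using \<alpha> by auto
    next
      case (backward u y q2' q2 q1)
      then have "snd p' = starts \<Sigma> (u # \<alpha>) (y # ys)"
        using \<alpha> by (simp add: starts_Cons)
      then show ?thesis using \<alpha>(1) backward by (metis lists.Cons)
    qed
  qed
  then show ?thesis by simp
qed

text \<open>Only backward transitions are taken, so the first component never changes;
  \<open>x0\<close> serves just to make it a nonempty initial choice. Induction on the word reads
  the path from its end.\<close>

lemma full_path_ver_states:
  assumes nfts: "is_nfts \<Sigma>" and x0: "x0 \<in> init \<Sigma>"
    and "\<alpha> \<in> lists (inputs \<Sigma>)" and "full_path \<Sigma> \<alpha> xs"
  shows "(init_out \<Sigma> (out \<Sigma> x0), starts \<Sigma> \<alpha> (map (out \<Sigma>) xs)) \<in> ver_states \<Sigma>"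
  using assms(3,4)
proof (induction arbitrary: xs rule: lists.induct)
  case Nil
  then obtain x where x: "x \<in> states \<Sigma>" "xs = [x]" by (auto simp: full_path_Nil)
  have "x0 \<in> states \<Sigma>" using x0 nfts by (auto simp: is_nfts_def)
  then have "x \<in> states_out \<Sigma> (out \<Sigma> x)" "x0 \<in> init_out \<Sigma> (out \<Sigma> x0)"
    "out \<Sigma> x \<in> outputs \<Sigma>" "out \<Sigma> x0 \<in> outputs \<Sigma>"
    using x x0 nfts by (auto simp: is_nfts_def states_out_def init_out_def)
  then have "(init_out \<Sigma> (out \<Sigma> x0), states_out \<Sigma> (out \<Sigma> x)) \<in> ver_init \<Sigma>"
    unfolding ver_init_def by blast
  then show ?case using x by (auto simp: starts_Nil ver_states_def)
next
  case (Cons u \<alpha>)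
  obtain x zs where xs: "xs = x # zs"
    using Cons.prems full_path_not_Nil by (cases xs) auto
  let ?q1 = "init_out \<Sigma> (out \<Sigma> x0)"
  let ?q = "starts \<Sigma> \<alpha> (map (out \<Sigma>) zs)" and ?q' = "starts \<Sigma> (u # \<alpha>) (map (out \<Sigma>) xs)"
  have "x \<in> states \<Sigma>" "full_path \<Sigma> \<alpha> zs"
    using Cons.prems by (auto simp: xs full_path_Cons)
  then have IH: "(?q1, ?q) \<in> ver_states \<Sigma>" and y: "out \<Sigma> x \<in> outputs \<Sigma>"
    using Cons.IH nfts by (auto simp: is_nfts_def)
  \<comment> \<open>The given path itself witnesses the nonemptiness that a backward transition
    requires.\<close>
  have "xs ! 0 \<in> ?q'" using Cons.prems unfolding starts_def by blast
  then have "?q' \<noteq> {}" by blast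
  moreover have "?q' = post \<Sigma> ?q u \<inter> states_out \<Sigma> (out \<Sigma> x)" by (simp add: xs starts_Cons)
  ultimately have "ver_step \<Sigma> (?q1, ?q) (None, Some u) (?q1, ?q')"
    using ver_step.backward Cons.hyps y by metis
  moreover have "(None, Some u) \<in> ver_inputs \<Sigma>" using Cons.hyps by (simp add: ver_inputs_def)
  ultimately show ?case
    using IH unfolding ver_states_def by (blast intro: rtranclp.rtrancl_into_rtrancl)
qed

theorem theorem5p3:
  fixes \<Sigma> :: "('x, 'u, 'y) nfts"
  assumes "is_nfts \<Sigma>" and "is_total \<Sigma>"
  shows "initial_state_opaque \<Sigma> \<longleftrightarrow>
    (\<forall>(q1, q2)\<in>ver_states \<Sigma>.
       q2 \<inter> init \<Sigma> \<noteq> {} \<longrightarrow> \<not> (q2 \<inter> init \<Sigma> \<subseteq> secret \<Sigma>))"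
proof (intro iffI)
  note run_iff = is_maximal_run_iff_full_path[OF assms]
  assume opaque: "initial_state_opaque \<Sigma>"
  have "\<not> q2 \<inter> init \<Sigma> \<subseteq> secret \<Sigma>"
    if q: "(q1, q2) \<in> ver_states \<Sigma>" and ne: "q2 \<inter> init \<Sigma> \<noteq> {}" for q1 q2
  proof
    assume sub: "q2 \<inter> init \<Sigma> \<subseteq> secret \<Sigma>"
    obtain \<alpha> ys where \<alpha>: "\<alpha> \<in> lists (inputs \<Sigma>)" and q2: "q2 = starts \<Sigma> \<alpha> ys"
      using ver_states_starts[OF q] by blast
    \<comment> \<open>Any state of \<open>q2\<close> in \<open>init\<close> is secret by
      \<open>sub\<close>, so the path behind it is a secret run to which opacity applies.\<close>
    obtain xs where xs: "full_path \<Sigma> \<alpha> xs" "map (out \<Sigma>) xs = ys" "xs ! 0 \<in> init \<Sigma>"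
      "xs ! 0 \<in> secret \<Sigma>"
      using ne sub unfolding q2 starts_def by blast
    then have "is_maximal_run \<Sigma> \<alpha> xs" using run_iff[OF \<alpha>] by simp
    then obtain xs' where xs': "is_maximal_run \<Sigma> \<alpha> xs'" "length xs' = length xs"
      "xs' ! 0 \<notin> secret \<Sigma>" "\<forall>j < length xs. out \<Sigma> (xs ! j) = out \<Sigma> (xs' ! j)"
      using opaque \<alpha> xs(3,4) unfolding initial_state_opaque_def by blast
    \<comment> \<open>Equal outputs place the start of the non-secret run in the same set
      \<open>q2\<close>.\<close>
    have "map (out \<Sigma>) xs' = ys" using xs' xs(2) by (auto intro!: nth_equalityI)
    moreover have "full_path \<Sigma> \<alpha> xs'" "xs' ! 0 \<in> init \<Sigma>" using run_iff[OF \<alpha>] xs'(1) by auto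
    ultimately have "xs' ! 0 \<in> q2 \<inter> init \<Sigma>" unfolding q2 starts_def by blast
    then show False using sub xs'(3) by blast
  qed
  then show "\<forall>(q1, q2)\<in>ver_states \<Sigma>.
       q2 \<inter> init \<Sigma> \<noteq> {} \<longrightarrow> \<not> (q2 \<inter> init \<Sigma> \<subseteq> secret \<Sigma>)" by blast
next
  note run_iff = is_maximal_run_iff_full_path[OF assms]
  assume ver: "\<forall>(q1, q2)\<in>ver_states \<Sigma>.
       q2 \<inter> init \<Sigma> \<noteq> {} \<longrightarrow> \<not> (q2 \<inter> init \<Sigma> \<subseteq> secret \<Sigma>)"
  show "initial_state_opaque \<Sigma>"
    unfolding initial_state_opaque_def
  proof (intro ballI allI impI)
    fix \<alpha> xs
    assume \<alpha>: "\<alpha> \<in> lists (inputs \<Sigma>)"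
      and "is_maximal_run \<Sigma> \<alpha> xs \<and> xs ! 0 \<in> init \<Sigma> \<inter> secret \<Sigma>"
    then have xs: "full_path \<Sigma> \<alpha> xs" "xs ! 0 \<in> init \<Sigma>" using run_iff[OF \<alpha>] by auto
    let ?q = "starts \<Sigma> \<alpha> (map (out \<Sigma>) xs)"
    have "xs ! 0 \<in> ?q \<inter> init \<Sigma>" using xs unfolding starts_def by blast
    \<comment> \<open>The secret start \<open>xs ! 0\<close> also serves as the initial state
      \<open>x0\<close> that fixes the first component.\<close>
    then have "\<not> (?q \<inter> init \<Sigma> \<subseteq> secret \<Sigma>)"
      using ver full_path_ver_states[OF assms(1) xs(2) \<alpha> xs(1)] by blast
    then obtain xs' where xs': "full_path \<Sigma> \<alpha> xs'" "map (out \<Sigma>) xs' = map (out \<Sigma>) xs"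
      "xs' ! 0 \<in> init \<Sigma>" "xs' ! 0 \<notin> secret \<Sigma>"
      unfolding starts_def by blast
    have len: "length xs' = length xs" using xs'(2) by (rule map_eq_imp_length_eq)
    have "\<forall>j < length xs. out \<Sigma> (xs ! j) = out \<Sigma> (xs' ! j)"
      using xs'(2) len by (metis nth_map)
    then show "\<exists>xs'. is_maximal_run \<Sigma> \<alpha> xs' \<and> length xs' = length xs \<and>
               xs' ! 0 \<notin> secret \<Sigma> \<and> (\<forall>j < length xs. out \<Sigma> (xs ! j) = out \<Sigma> (xs' ! j))"
      using run_iff[OF \<alpha>] xs' len by blast
  qed
qed

end
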